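(* Let $\mathbb{K}=\mathbb{R}$ or $\mathbb{K}=\mathbb{C}$, let $(H,\langle\cdot,\cdot\rangle)$ be an inner product space over $\mathbb{K}$ and let $e\in H$ with $\|e\|=1$. Let $\gamma,\Gamma\in\mathbb{K}$ and $x,y\in H$ be such that $$\operatorname{Re}\left\langle \Gamma e-\frac{x+y}{2},\,\frac{x+y}{2}-\gamma e\right\rangle\ge 0,$$ or, equivalently, $$\left\|\frac{x+y}{2}-\frac{\gamma+\Gamma}{2}e\right\|\le\frac12|\Gamma-\gamma|.$$ Then $$\operatorname{Re}\left[\langle x,y\rangle-\langle x,e\rangle\langle e,y\rangle\right]\le\frac14|\Gamma-\gamma|^2.$$ The constant $\frac14$ is best possible in the sense that it cannot be replaced by a smaller constant: for every real $c<\frac14$ there exist an inner product space $H$ over $\mathbb{K}$ and $e,x,y\in H$, $\gamma,\Gamma\in\mathbb{K}$ satisfying $\|e\|=1$ and $\operatorname{Re}\left\langle \Gamma e-\frac{x+y}{2},\,\frac{x+y}{2}-\gamma e\right\rangle\ge 0$ for which the inequality with $\frac14$ replaced by $c$, namely $\operatorname{Re}\left[\langle x,y\rangle-\langle x,e\rangle\langle e,y\rangle\right]\le c\,|\Gamma-\gamma|^2$, fails.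
   Context: Inner products are linear in the first argument and conjugate-linear in the second; $\|x\|=\langle x,x\rangle^{1/2}$. *)

theory Defs
  imports Complex_Main "HOL-Library.Product_Plus"
begin

text \<open>
  The scalar field: a normed field with conjugation and real part. The instances
  \<open>real\<close> and \<open>complex\<close> are given below, and the lemma \<open>real_or_complex_cases\<close>
  shows that, up to isomorphism preserving all the structure, there are no others.
\<close>

class real_or_complex = real_normed_field +
  fixes kconj :: "'a \<Rightarrow> 'a"
    and kRe :: "'a \<Rightarrow> real"
  assumes kconj_add: "kconj (a + b) = kconj a + kconj b"
    and kconj_mult: "kconj (a * b) = kconj a * kconj b"
    and kconj_kconj: "kconj (kconj a) = a"
    and kRe_scaleR: "kRe a *\<^sub>R 1 = (a + kconj a) / 2"
    and mult_kconj_scaleR: "a * kconj a = (norm a)\<^sup>2 *\<^sub>R 1"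

lemma of_real_kRe: "of_real (kRe a) = (a + kconj a) / (2 :: 'k::real_or_complex)"
  by (simp add: of_real_def kRe_scaleR)

lemma mult_kconj: "a * kconj a = (of_real ((norm a)\<^sup>2) :: 'k::real_or_complex)"
  by (simp add: of_real_def mult_kconj_scaleR)

instantiation real :: real_or_complex
begin

definition kconj_real :: "real \<Rightarrow> real" where "kconj_real a = a"

definition kRe_real :: "real \<Rightarrow> real" where "kRe_real a = a"

instance
  by standard (simp_all add: kconj_real_def kRe_real_def power2_eq_square)

end

instantiation complex :: real_or_complex
begin

definition kconj_complex :: "complex \<Rightarrow> complex" where "kconj_complex = cnj"

definition kRe_complex :: "complex \<Rightarrow> real" where "kRe_complex = Re"

instance
  by standard (simp_all add: kconj_complex_def kRe_complex_def complex_eq_iff cmod_def power2_eq_square)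

end

lemma real_or_complex_cases:
  obtains (real) "\<And>z :: 'k::real_or_complex. \<exists>r. z = of_real r \<and> kconj z = of_real r \<and> kRe z = r \<and> norm z = \<bar>r\<bar>"
  | (complex) j :: "'k::real_or_complex" where "j * j = - 1"
      "\<And>z :: 'k::real_or_complex. \<exists>r s. z = of_real r + of_real s * j \<and> kconj z = of_real r - of_real s * j \<and>
         kRe z = r \<and> norm z = sqrt (r\<^sup>2 + s\<^sup>2)"
proof -
  have half: "of_real (kRe z) = z" if "kconj z = z" for z :: 'k
    using of_real_kRe[of z] that by simp
  have conj0: "kconj 0 = (0 :: 'k)"
    using kconj_add[of 0 "0 :: 'k"] by simp
  have conj_minus: "kconj (- z) = - kconj z" for z :: 'k
    using kconj_add[of z "- z"] conj0 by (simp add: eq_neg_iff_add_eq_0 add.commute)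
  have conj_diff: "kconj (z - w) = kconj z - kconj w" for z w :: 'k
    using kconj_add[of z "- w"] conj_minus[of w] by simp
  show thesis
  proof (cases "\<forall>z :: 'k. kconj z = z")
    case True
    show thesis
    proof (rule real)
      fix z :: 'k
      have "z = of_real (kRe z)" using True half[of z] by simp
      then have "norm z = \<bar>kRe z\<bar>" by (metis norm_of_real)
      then show "\<exists>r. z = of_real r \<and> kconj z = of_real r \<and> kRe z = r \<and> norm z = \<bar>r\<bar>"
        using True \<open>z = of_real (kRe z)\<close> by metis
    qed
  next
    case False
    then obtain w :: 'k where w: "kconj w \<noteq> w" by blast
    define d where "d = w - kconj w"
    have d0: "d \<noteq> 0" using w by (auto simp: d_def)
    have cd: "kconj d = - d" by (simp add: d_def conj_diff kconj_kconj)
    have dd: "d * d = - of_real ((norm d)\<^sup>2)"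
      using mult_kconj[of d] cd by (metis add.inverse_inverse mult_minus_right)
    have cof: "kconj (of_real r) = (of_real r :: 'k)" for r
    proof (cases "r = 0")
      case True
      then show ?thesis by (simp add: conj0)
    next
      case False
      have "of_real r * kconj (of_real r) = (of_real r * of_real r :: 'k)"
        by (simp add: mult_kconj power2_eq_square)
      then show ?thesis using False by simp
    qed
    define j where "j = of_real (1 / norm d) * d"
    have cj: "kconj j = - j" by (simp only: j_def kconj_mult cof cd mult_minus_right)
    have "j * j = of_real (1 / norm d) * of_real (1 / norm d) * (d * d)"
      by (simp add: j_def algebra_simps)
    also have "\<dots> = - of_real (1 / norm d * (1 / norm d) * (norm d)\<^sup>2)"
      by (simp only: dd of_real_mult mult_minus_right)
    also have "1 / norm d * (1 / norm d) * (norm d)\<^sup>2 = 1"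
      using d0 by (simp add: power2_eq_square)
    finally have jj: "j * j = - 1" by simp
    show thesis
    proof (rule complex)
      show "j * j = - 1" by (fact jj)
      fix z :: 'k
      define v where "v = (z - kconj z) / 2"
      define r where "r = kRe z"
      define s where "s = - kRe (v * j)"
      have c2: "kconj 2 = (2 :: 'k)" using cof[of 2] by simp
      have v2: "2 * v = z - kconj z" by (simp add: v_def)
      have "kconj (2 * v) = - (2 * v)"
        by (simp only: v2 conj_diff kconj_kconj) simp
      then have cv: "kconj v = - v" by (simp add: kconj_mult c2)
      have "kconj (v * j) = v * j" by (simp add: kconj_mult cv cj)
      then have vj: "of_real s = - (v * j)" using half[of "v * j"] by (simp add: s_def)
      have vs: "of_real s * j = v" using jj by (simp add: vj mult.assoc)
      have rz: "of_real r = (z + kconj z) / 2" by (simp add: r_def of_real_kRe)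
      have "of_real r + v = (z + kconj z + (z - kconj z)) / 2"
        by (simp only: rz v_def add_divide_distrib)
      then have z: "z = of_real r + of_real s * j" by (simp add: vs)
      have cz: "kconj z = of_real r - of_real s * j"
        by (subst z) (simp add: kconj_add kconj_mult cof cj)
      have "of_real ((norm z)\<^sup>2) = z * kconj z" by (simp add: mult_kconj)
      also have "\<dots> = of_real r * of_real r - of_real s * of_real s * (j * j)"
        by (simp only: z[symmetric] cz) (subst z, simp add: algebra_simps)
      also have "\<dots> = of_real (r\<^sup>2 + s\<^sup>2)" by (simp add: jj power2_eq_square)
      finally have "(norm z)\<^sup>2 = r\<^sup>2 + s\<^sup>2" by (simp only: of_real_eq_iff)
      then have "norm z = sqrt (r\<^sup>2 + s\<^sup>2)" by (simp add: real_sqrt_unique)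
      then show "\<exists>r s. z = of_real r + of_real s * j \<and> kconj z = of_real r - of_real s * j \<and>
         kRe z = r \<and> norm z = sqrt (r\<^sup>2 + s\<^sup>2)"
        using z cz r_def[symmetric] by (intro exI[of _ r] exI[of _ s] conjI)
    qed
  qed
qed

locale inner_product_space = vector_space scale
  for scale :: "'k::real_or_complex \<Rightarrow> 'a::ab_group_add \<Rightarrow> 'a" +
  fixes ip :: "'a \<Rightarrow> 'a \<Rightarrow> 'k"
  assumes ip_add_left: "ip (x + y) z = ip x z + ip y z"
    and ip_scale_left: "ip (scale a x) y = a * ip x y"
    and ip_conj_sym: "ip y x = kconj (ip x y)"
    and ip_nonneg: "0 \<le> kRe (ip x x)"
    and ip_definite: "ip x x = 0 \<Longrightarrow> x = 0"

text \<open>By \<open>ip_conj_sym\<close>, \<open>ip x x\<close> is a real scalar, so taking its real part loses nothing.\<close>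

definition ip_norm :: "('a \<Rightarrow> 'a \<Rightarrow> 'k::real_or_complex) \<Rightarrow> 'a \<Rightarrow> real" where
  "ip_norm ip x = sqrt (kRe (ip x x))"

end

theory Submission
  imports Defs
begin

text \<open>
  Write \<open>m = (x + y) / 2\<close> for the midpoint. The real part of an inner product satisfies
  \<open>Re \<langle>p - q, p + q\<rangle> = \<parallel>p\<parallel>\<^sup>2 - \<parallel>q\<parallel>\<^sup>2\<close>, because the cross terms \<open>\<langle>p, q\<rangle>\<close> and \<open>\<langle>q, p\<rangle>\<close> are
  conjugate to each other (\<open>kRe_ip_diff_add\<close>). This identity is used twice.

  With \<open>p = ((\<Gamma> - \<gamma>) / 2) e\<close> and \<open>q = m - ((\<gamma> + \<Gamma>) / 2) e\<close> the two factors are \<open>\<Gamma> e - m\<close> and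
  \<open>m - \<gamma> e\<close>, so the first hypothesis says \<open>\<parallel>q\<parallel>\<^sup>2 \<le> \<bar>\<Gamma> - \<gamma>\<bar>\<^sup>2 / 4\<close>, which is the second one: \<open>m\<close> lies in
  the ball whose diameter joins \<open>\<gamma> e\<close> to \<open>\<Gamma> e\<close>.

  For the inequality, let \<open>P\<close> be the orthogonal projection onto the complement of \<open>e\<close>. Then
  \<open>\<langle>x, y\<rangle> - \<langle>x, e\<rangle>\<langle>e, y\<rangle> = \<langle>P x, P y\<rangle>\<close>. Since \<open>P x\<close> and \<open>P y\<close> lie symmetrically about \<open>P m\<close>, the
  same identity bounds the real part by \<open>\<parallel>P m\<parallel>\<^sup>2\<close>. Now \<open>P\<close> kills multiples of \<open>e\<close> and does not increase
  norms, hence \<open>\<parallel>P m\<parallel>\<^sup>2 = \<parallel>P q\<parallel>\<^sup>2 \<le> \<parallel>q\<parallel>\<^sup>2\<close>.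

  Every inequality used becomes an equality when \<open>x = y\<close> is a unit vector orthogonal to \<open>e\<close> and
  \<open>\<Gamma> = 1 = - \<gamma>\<close>; in the plane over the scalar field this shows that \<open>1/4\<close> is optimal.
\<close>

section \<open>Conjugation and real part\<close>

lemma kconj_0 [simp]: "kconj (0 :: 'k::real_or_complex) = 0"
  using kconj_add[of 0 "0 :: 'k"] by simp

lemma kconj_1 [simp]: "kconj (1 :: 'k::real_or_complex) = 1"
  using mult_kconj[of "1 :: 'k"] by simp

lemma kRe_add: "kRe (a + b) = kRe a + kRe (b :: 'k::real_or_complex)"
proof -
  have "(of_real (kRe (a + b)) :: 'k) = of_real (kRe a + kRe b)"
    by (simp only: of_real_add of_real_kRe kconj_add add_divide_distrib[symmetric] ac_simps)
  then show ?thesis by (simp only: of_real_eq_iff)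
qed

lemma kRe_0 [simp]: "kRe (0 :: 'k::real_or_complex) = 0"
  using kRe_add[of 0 "0 :: 'k"] by simp

lemma kRe_minus: "kRe (- a) = - kRe (a :: 'k::real_or_complex)"
  using kRe_add[of a "- a"] by simp

lemma kRe_diff: "kRe (a - b) = kRe a - kRe (b :: 'k::real_or_complex)"
  using kRe_add[of a "- b"] by (simp add: kRe_minus)

lemma kRe_kconj: "kRe (kconj a) = kRe (a :: 'k::real_or_complex)"
proof -
  have "(of_real (kRe (kconj a)) :: 'k) = of_real (kRe a)"
    by (simp only: of_real_kRe kconj_kconj add.commute)
  then show ?thesis by (simp only: of_real_eq_iff)
qed

lemma of_real_kRe_self_conj: "kconj z = z \<Longrightarrow> of_real (kRe z) = (z :: 'k::real_or_complex)"
  by (simp add: of_real_kRe)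

lemma kRe_mult_kconj: "kRe (a * kconj a) = (norm (a :: 'k::real_or_complex))\<^sup>2"
proof -
  have "kconj (a * kconj a) = a * kconj a"
    by (simp add: kconj_mult kconj_kconj mult.commute)
  from of_real_kRe_self_conj[OF this] show ?thesis
    by (simp only: mult_kconj of_real_eq_iff)
qed

lemma kRe_1: "kRe (1 :: 'k::real_or_complex) = 1"
  using kRe_mult_kconj[of "1 :: 'k"] by simp

section \<open>The projection onto the complement of a unit vector\<close>

context inner_product_space
begin

lemma ip_add_right: "ip z (x + y) = ip z x + ip z y"
  by (metis ip_add_left ip_conj_sym kconj_add)

lemma ip_scale_right: "ip x (scale a y) = kconj a * ip x y"
  by (metis ip_scale_left ip_conj_sym kconj_mult)

lemma ip_diff_left: "ip (x - y) z = ip x z - ip y z"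
  using ip_add_left[of "x - y" y z] by simp

lemma ip_diff_right: "ip z (x - y) = ip z x - ip z y"
  using ip_add_right[of z "x - y" y] by simp

lemma kRe_ip_diff_add: "kRe (ip (p - q) (p + q)) = kRe (ip p p) - kRe (ip q q)"
proof -
  have "kRe (ip q p) = kRe (ip p q)"
    by (metis ip_conj_sym kRe_kconj)
  then show ?thesis
    by (simp add: ip_diff_left ip_add_right kRe_add kRe_diff)
qed

lemma ip_unit_vector:
  assumes "ip_norm ip e = 1"
  shows "ip e e = 1"
  using assms of_real_kRe_self_conj[of "ip e e"] ip_conj_sym[of e e]
  by (simp add: ip_norm_def)

lemma ip_norm_le_iff:
  assumes "0 \<le> r"
  shows "ip_norm ip v \<le> r \<longleftrightarrow> kRe (ip v v) \<le> r\<^sup>2"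
  unfolding ip_norm_def using assms by (auto intro: real_le_lsqrt dest: sqrt_le_D)

definition perp :: "'a \<Rightarrow> 'a \<Rightarrow> 'a" where
  "perp e x = x - scale (ip x e) e"

lemma perp_add: "perp e (x + y) = perp e x + perp e y"
  by (simp add: perp_def ip_add_left scale_left_distrib)

lemma perp_diff_scale:
  assumes "ip e e = 1"
  shows "perp e (x - scale a e) = perp e x"
  using assms by (simp add: perp_def ip_diff_left ip_scale_left scale_left_diff_distrib)

lemma ip_perp_perp:
  assumes "ip e e = 1"
  shows "ip (perp e x) (perp e y) = ip x y - ip x e * ip e y"
proof -
  have "kconj (ip y e) = ip e y"
    by (metis ip_conj_sym)
  then show ?thesis
    using assms
    by (simp add: perp_def ip_diff_left ip_diff_right ip_scale_left ip_scale_right algebra_simps)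
qed

text \<open>By Pythagoras, the part removed by the projection has squared norm \<open>\<bar>\<langle>w, e\<rangle>\<bar>\<^sup>2\<close>.\<close>

lemma kRe_ip_perp_le:
  assumes "ip e e = 1"
  shows "kRe (ip (perp e w) (perp e w)) \<le> kRe (ip w w)"
proof -
  have "ip w e * ip e w = ip w e * kconj (ip w e)"
    by (metis ip_conj_sym)
  then have "kRe (ip w e * ip e w) = (norm (ip w e))\<^sup>2"
    by (simp only: kRe_mult_kconj)
  then show ?thesis
    by (simp add: ip_perp_perp[OF assms] kRe_diff)
qed

section \<open>The ball condition and the inequality\<close>

text \<open>
  The difference-of-squares identity with half the difference and half the sum of the two
  endpoints: a point sees the segment from \<open>\<gamma> e\<close> to \<open>\<Gamma> e\<close> under an angle of at least
  ninety degrees exactly when it lies in the ball having that segment as diameter.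
\<close>

lemma kRe_ip_segment:
  assumes "ip e e = 1"
  shows "kRe (ip (scale \<Gamma> e - m) (m - scale \<gamma> e))
    = (1/2 * norm (\<Gamma> - \<gamma>))\<^sup>2 - kRe (ip (m - scale ((\<gamma> + \<Gamma>) / 2) e) (m - scale ((\<gamma> + \<Gamma>) / 2) e))"
proof -
  define h where "h = (\<Gamma> - \<gamma>) / 2"
  define b where "b = (\<gamma> + \<Gamma>) / 2"
  have \<Gamma>: "\<Gamma> = b + h" and \<gamma>: "\<gamma> = b - h"
    by (simp_all add: h_def b_def field_simps)
  have "scale \<Gamma> e - m = scale h e - (m - scale b e)" "m - scale \<gamma> e = scale h e + (m - scale b e)"
    by (simp_all add: \<Gamma> \<gamma> scale_left_distrib scale_left_diff_distrib)
  moreover have "kRe (ip (scale h e) (scale h e)) = (norm h)\<^sup>2"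
    by (simp add: ip_scale_left ip_scale_right assms kRe_mult_kconj mult.commute[of "kconj h"])
  moreover have "norm h = 1/2 * norm (\<Gamma> - \<gamma>)"
    by (simp add: h_def norm_divide)
  ultimately show ?thesis
    by (simp only: kRe_ip_diff_add b_def)
qed

text \<open>
  For a given midpoint the left-hand side is largest when the projections of \<open>x\<close> and \<open>y\<close>
  coincide, since moving them apart symmetrically subtracts a squared norm. The scalar \<open>a\<close> is
  free because the projection does not see multiples of \<open>e\<close>.
\<close>

lemma kRe_gruss_le_midpoint:
  assumes e: "ip e e = 1"
  shows "kRe (ip x y - ip x e * ip e y)
    \<le> kRe (ip (scale (1/2) (x + y) - scale a e) (scale (1/2) (x + y) - scale a e))"
proof -
  define m where "m = scale (1/2) (x + y)"
  define p where "p = perp e m"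
  define q where "q = perp e y - p"
  have "m + m = x + y"
    by (simp add: m_def scale_left_distrib[symmetric])
  then have "perp e x + perp e y = p + p"
    by (metis perp_add p_def)
  then have xy: "perp e x = p - q" "perp e y = p + q"
    by (simp_all add: q_def algebra_simps)
  have "kRe (ip x y - ip x e * ip e y) = kRe (ip p p) - kRe (ip q q)"
    by (simp only: ip_perp_perp[OF e, symmetric] xy kRe_ip_diff_add)
  also have "\<dots> \<le> kRe (ip p p)"
    by (simp add: ip_nonneg)
  also have "p = perp e (m - scale a e)"
    by (simp add: p_def perp_diff_scale[OF e])
  also have "kRe (ip \<dots> \<dots>) \<le> kRe (ip (m - scale a e) (m - scale a e))"
    by (rule kRe_ip_perp_le[OF e])
  finally show ?thesis by (simp only: m_def)
qed

end

section \<open>The standard plane\<close>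

definition plane_scale :: "'k::real_or_complex \<Rightarrow> 'k \<times> 'k \<Rightarrow> 'k \<times> 'k" where
  "plane_scale a v = (a * fst v, a * snd v)"

definition plane_ip :: "'k::real_or_complex \<times> 'k \<Rightarrow> 'k \<times> 'k \<Rightarrow> 'k" where
  "plane_ip v w = fst v * kconj (fst w) + snd v * kconj (snd w)"

lemma inner_product_space_plane:
  "inner_product_space (plane_scale :: 'k::real_or_complex \<Rightarrow> _) plane_ip"
proof
  fix v :: "'k \<times> 'k"
  have sq: "plane_ip v v = of_real ((norm (fst v))\<^sup>2 + (norm (snd v))\<^sup>2)"
    by (simp add: plane_ip_def mult_kconj)
  show "0 \<le> kRe (plane_ip v v)"
    by (simp add: plane_ip_def kRe_add kRe_mult_kconj)
  assume "plane_ip v v = 0"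
  then have "(norm (fst v))\<^sup>2 + (norm (snd v))\<^sup>2 = 0"
    unfolding sq by (simp only: of_real_eq_0_iff)
  then show "v = 0"
    by (simp add: sum_power2_eq_zero_iff prod_eq_iff)
qed (simp_all add: plane_scale_def plane_ip_def prod_eq_iff kconj_add kconj_mult kconj_kconj
      algebra_simps)

section \<open>The inequality and its sharpness\<close>

theorem theorem4:
  shows "(\<forall>(scale :: 'k::real_or_complex \<Rightarrow> 'a::ab_group_add \<Rightarrow> 'a) ip e x y \<gamma> \<Gamma>.
            inner_product_space scale ip \<longrightarrow> ip_norm ip e = 1 \<longrightarrow>
            (kRe (ip (scale \<Gamma> e - scale (1/2) (x + y)) (scale (1/2) (x + y) - scale \<gamma> e)) \<ge> 0
              \<longleftrightarrow> ip_norm ip (scale (1/2) (x + y) - scale ((\<gamma> + \<Gamma>) / 2) e) \<le> 1/2 * norm (\<Gamma> - \<gamma>))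
            \<and>
            (kRe (ip (scale \<Gamma> e - scale (1/2) (x + y)) (scale (1/2) (x + y) - scale \<gamma> e)) \<ge> 0
              \<longrightarrow> kRe (ip x y - ip x e * ip e y) \<le> 1/4 * (norm (\<Gamma> - \<gamma>))\<^sup>2))
       \<and> (\<forall>c::real. c < 1/4 \<longrightarrow>
            (\<exists>(scale :: 'k \<Rightarrow> 'k \<times> 'k \<Rightarrow> 'k \<times> 'k) ip e x y \<gamma> \<Gamma>.
               inner_product_space scale ip \<and> ip_norm ip e = 1 \<and>
               kRe (ip (scale \<Gamma> e - scale (1/2) (x + y)) (scale (1/2) (x + y) - scale \<gamma> e)) \<ge> 0 \<and>
               \<not> kRe (ip x y - ip x e * ip e y) \<le> c * (norm (\<Gamma> - \<gamma>))\<^sup>2))"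
proof (intro conjI allI impI)
  fix scale :: "'k \<Rightarrow> 'a \<Rightarrow> 'a" and ip e x y \<gamma> \<Gamma>
  assume "inner_product_space scale ip" and "ip_norm ip e = 1"
  interpret inner_product_space scale ip by fact
  have e: "ip e e = 1" by (rule ip_unit_vector) fact
  let ?m = "scale (1/2) (x + y)"
  let ?w = "?m - scale ((\<gamma> + \<Gamma>) / 2) e"
  show "kRe (ip (scale \<Gamma> e - ?m) (?m - scale \<gamma> e)) \<ge> 0
      \<longleftrightarrow> ip_norm ip ?w \<le> 1/2 * norm (\<Gamma> - \<gamma>)"
    by (subst ip_norm_le_iff) (simp_all add: kRe_ip_segment[OF e])
  assume "kRe (ip (scale \<Gamma> e - ?m) (?m - scale \<gamma> e)) \<ge> 0"
  then have "kRe (ip ?w ?w) \<le> 1/4 * (norm (\<Gamma> - \<gamma>))\<^sup>2"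
    by (simp add: kRe_ip_segment[OF e] power_divide)
  with kRe_gruss_le_midpoint[OF e, of x y]
  show "kRe (ip x y - ip x e * ip e y) \<le> 1/4 * (norm (\<Gamma> - \<gamma>))\<^sup>2"
    by (rule order_trans)
next
  fix c :: real
  assume c: "c < 1/4"
  let ?e = "(1, 0) :: 'k \<times> 'k" and ?x = "(0, 1) :: 'k \<times> 'k"
  have m: "plane_scale (1/2) (?x + ?x) = ?x"
    by (simp add: plane_scale_def)
  have "norm (1 - (- 1) :: 'k) = 2"
    by simp
  then have "\<not> kRe (plane_ip ?x ?x - plane_ip ?x ?e * plane_ip ?e ?x) \<le> c * (norm (1 - (- 1) :: 'k))\<^sup>2"
    using c by (simp add: plane_ip_def kRe_1)
  moreover have "ip_norm plane_ip ?e = 1"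
    by (simp add: ip_norm_def plane_ip_def kRe_1)
  moreover have "kRe (plane_ip (plane_scale 1 ?e - plane_scale (1/2) (?x + ?x))
      (plane_scale (1/2) (?x + ?x) - plane_scale (- 1) ?e)) \<ge> 0"
    unfolding m by (simp add: plane_ip_def plane_scale_def)
  ultimately show "\<exists>(scale :: 'k \<Rightarrow> 'k \<times> 'k \<Rightarrow> 'k \<times> 'k) ip e x y \<gamma> \<Gamma>.
      inner_product_space scale ip \<and> ip_norm ip e = 1 \<and>
      kRe (ip (scale \<Gamma> e - scale (1/2) (x + y)) (scale (1/2) (x + y) - scale \<gamma> e)) \<ge> 0 \<and>
      \<not> kRe (ip x y - ip x e * ip e y) \<le> c * (norm (\<Gamma> - \<gamma>))\<^sup>2"
    using inner_product_space_plane by blast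
qed

end
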